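(* Let $\eta_1,\eta_2$ be defined from the five elastic constants as in the context, with $\eta_1,\eta_2>0$. Let $K:\mathbb{R}^2\setminus\{0\}\to\mathbb{R}$ be $$K(z)=\eta_1\eta_2\frac{Az_1^4+Bz_1^2z_2^2+Cz_2^4}{|z|(\eta_1z_1^2+\eta_2z_2^2)^3},$$ with $A=3\eta_1^2-2\eta_1\eta_2$, $B=2(3\eta_1^2-5\eta_1\eta_2+3\eta_2^2)$, $C=3\eta_2^2-2\eta_1\eta_2$. Then: (i) $K(x)=K(-x)$ and $K(\rho x)=\rho^{-3}K(x)$ for $\rho>0$. (ii) For any multi-index $a\in\mathbb{N}_0^2$ there is a constant $C$ such that $|x^aD^aK(x)|<\frac{C}{|x|^3}$ for any $x\ne0$. (iii) $K$ is the unique solution, in $C^\infty(\mathbb{R}^2\setminus\{0\})$, that is homogeneous of order $-3$, to the equation $$(\eta_2\partial_1^2+\eta_1\partial_2^2)K(z)=\eta_1\eta_2(\partial_1^2+\partial_2^2)\left[\frac1{|z|^3}\right].$$ (iv) Suppose that the five elastic constants are such that $\frac23<\frac{\eta_1}{\eta_2}<\frac32$. Then there exist positive constants $c$ and $C$ depending only on the five elastic constants such that $\frac{c}{|x|^3}\le K(x)\le\frac{C}{|x|^3}$ for all $x\in\mathbb{R}^2\setminus\{0\}$.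
   Context: The five real elastic constants $C_{11},C_{13},C_{33},C_{44},C_{66}$ satisfy $0<C_{66}<C_{11}$, $C_{13}^2<C_{33}(C_{11}-C_{66})$, $C_{44}>0$, and $\eta_1=2\sqrt{C_{44}C_{66}}$, $$\eta_2=\frac1\tau\left(C_{11}-C_{13}-C_{44}+\frac{C_{13}C_{44}}{C_{33}}+\frac{\sqrt{C_{11}C_{33}}(C_{33}-C_{13})(C_{44}+C_{13})}{C_{33}^2}\right),\quad \tau=\frac{\sqrt{\sqrt{C_{11}C_{33}}-C_{13}}\sqrt{\sqrt{C_{11}C_{33}}+C_{13}+2C_{44}}}{2\sqrt{C_{33}C_{44}}}.$$ For a multi-index $a=(a_1,a_2)$, $x^a=x_1^{a_1}x_2^{a_2}$ and $D^a=\partial_1^{a_1}\partial_2^{a_2}$. Homogeneous of order $-3$ means $f(\rho x)=\rho^{-3}f(x)$ for $\rho>0$.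
   Formalization: In (iii), uniqueness is asserted only among even functions homogeneous of order -3; without evenness it fails, since Re((z_1/√η_2 + i z_2/√η_1)^{-3}) is a nonzero smooth homogeneous solution of the homogeneous equation. *)

theory Defs
  imports "HOL-Analysis.Analysis"
begin

section \<open>Partial derivatives and smoothness\<close>

definition partial :: "'n::finite \<Rightarrow> (real^'n \<Rightarrow> real) \<Rightarrow> real^'n \<Rightarrow> real" where
  "partial i f x = deriv (\<lambda>t. f (x + t *\<^sub>R axis i 1)) 0"

text \<open>\<open>deriv\<close> is total; \<open>C_k_on\<close> below demands that every partial derivative it mentions
  really exists. It is meant for open \<open>S\<close>.\<close>

primrec C_k_on :: "nat \<Rightarrow> (real^'n::finite \<Rightarrow> real) \<Rightarrow> (real^'n) set \<Rightarrow> bool" where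
  "C_k_on 0 f S \<longleftrightarrow> continuous_on S f"
| "C_k_on (Suc k) f S \<longleftrightarrow> continuous_on S f \<and>
     (\<forall>i. (\<forall>x\<in>S. (\<lambda>t. f (x + t *\<^sub>R axis i 1)) field_differentiable (at 0))
          \<and> C_k_on k (partial i f) S)"

definition C_infinity_on :: "(real^'n::finite \<Rightarrow> real) \<Rightarrow> (real^'n) set \<Rightarrow> bool" where
  "C_infinity_on f S \<longleftrightarrow> (\<forall>k. C_k_on k f S)"

definition monomial :: "nat \<times> nat \<Rightarrow> real^2 \<Rightarrow> real" where
  "monomial a x = (x $ 1) ^ fst a * (x $ 2) ^ snd a"

definition multi_deriv :: "nat \<times> nat \<Rightarrow> (real^2 \<Rightarrow> real) \<Rightarrow> real^2 \<Rightarrow> real" where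
  "multi_deriv a f = (partial 1 ^^ fst a) ((partial 2 ^^ snd a) f)"

text \<open>Functions on the punctured plane are total functions whose value at the origin is never
  used.\<close>

definition homogeneous_of_order :: "int \<Rightarrow> (real^2 \<Rightarrow> real) \<Rightarrow> bool" where
  "homogeneous_of_order d f \<longleftrightarrow> (\<forall>\<rho>>0. \<forall>x. x \<noteq> 0 \<longrightarrow> f (\<rho> *\<^sub>R x) = \<rho> powi d * f x)"

definition even_function :: "(real^2 \<Rightarrow> real) \<Rightarrow> bool" where
  "even_function f \<longleftrightarrow> (\<forall>x. x \<noteq> 0 \<longrightarrow> f x = f (- x))"


section \<open>Elastic constants and the kernel\<close>

definition eta1 :: "real \<Rightarrow> real \<Rightarrow> real" where
  "eta1 C44 C66 = 2 * sqrt (C44 * C66)"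

definition tau :: "real \<Rightarrow> real \<Rightarrow> real \<Rightarrow> real \<Rightarrow> real" where
  "tau C11 C13 C33 C44 =
     sqrt (sqrt (C11 * C33) - C13) * sqrt (sqrt (C11 * C33) + C13 + 2 * C44)
       / (2 * sqrt (C33 * C44))"

definition eta2 :: "real \<Rightarrow> real \<Rightarrow> real \<Rightarrow> real \<Rightarrow> real" where
  "eta2 C11 C13 C33 C44 =
     1 / tau C11 C13 C33 C44 *
       (C11 - C13 - C44 + C13 * C44 / C33
        + sqrt (C11 * C33) * (C33 - C13) * (C44 + C13) / C33\<^sup>2)"

definition kernel :: "real \<Rightarrow> real \<Rightarrow> real^2 \<Rightarrow> real" where
  "kernel \<eta>1 \<eta>2 z =
     (let A = 3 * \<eta>1\<^sup>2 - 2 * \<eta>1 * \<eta>2;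
          B = 2 * (3 * \<eta>1\<^sup>2 - 5 * \<eta>1 * \<eta>2 + 3 * \<eta>2\<^sup>2);
          C = 3 * \<eta>2\<^sup>2 - 2 * \<eta>1 * \<eta>2
      in \<eta>1 * \<eta>2 * ((A * (z $ 1) ^ 4 + B * (z $ 1)\<^sup>2 * (z $ 2)\<^sup>2 + C * (z $ 2) ^ 4)
           / (norm z * (\<eta>1 * (z $ 1)\<^sup>2 + \<eta>2 * (z $ 2)\<^sup>2) ^ 3)))"

definition solves_kernel_pde :: "real \<Rightarrow> real \<Rightarrow> (real^2 \<Rightarrow> real) \<Rightarrow> bool" where
  "solves_kernel_pde \<eta>1 \<eta>2 f \<longleftrightarrow>
     (\<forall>z. z \<noteq> 0 \<longrightarrow>
        \<eta>2 * multi_deriv (2, 0) f z + \<eta>1 * multi_deriv (0, 2) f z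
        = \<eta>1 * \<eta>2 * (multi_deriv (2, 0) (\<lambda>w. 1 / norm w ^ 3) z
                     + multi_deriv (0, 2) (\<lambda>w. 1 / norm w ^ 3) z))"

text \<open>The candidates among which the kernel is the unique solution. Evenness cannot be dropped:
  with \<open>w = z\<^sub>1 / \<surd>\<eta>2 + \<i> z\<^sub>2 / \<surd>\<eta>1\<close>, the functions \<open>Re (1 / w ^ 3)\<close> and
  \<open>Im (1 / w ^ 3)\<close> are nonzero, smooth off the origin, homogeneous of order \<open>-3\<close> and annihilated
  by \<open>\<eta>2 \<partial>\<^sub>1\<^sup>2 + \<eta>1 \<partial>\<^sub>2\<^sup>2\<close>, but they are odd.\<close>

definition admissible_solution :: "real \<Rightarrow> real \<Rightarrow> (real^2 \<Rightarrow> real) \<Rightarrow> bool" where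
  "admissible_solution \<eta>1 \<eta>2 f \<longleftrightarrow>
     C_infinity_on f (UNIV - {0}) \<and> homogeneous_of_order (-3) f \<and> even_function f
     \<and> solves_kernel_pde \<eta>1 \<eta>2 f"

end

theory Submission
  imports Defs
begin

text \<open>
  The decay of the derivatives rests on smoothness and homogeneity alone. The kernel is a
  polynomial in the coordinates, \<open>1 / \<bar>z\<bar>\<close> and \<open>1 / (\<eta>1 z\<^sub>1\<^sup>2 + \<eta>2 z\<^sub>2\<^sup>2)\<close>, and these polynomials are closed
  under partial differentiation, so \<open>K\<close> is smooth off the origin
  (\<open>C_infinity_on_if_closed_under_partials\<close>, \<open>smooth_fractions_partial\<close>). Each partial derivative
  lowers the order of homogeneity by one and each coordinate raises it by one, so \<open>x\<^sup>a D\<^sup>a K\<close> is again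
  homogeneous of order \<open>-3\<close> and is controlled by the maximum of its absolute value on the unit circle. The two-sided bound
  follows in the same way once \<open>K\<close> is positive, and it is: for \<open>2/3 < \<eta>1/\<eta>2 < 3/2\<close> all the
  coefficients of its numerator are positive.

  That \<open>K\<close> solves the equation is a computation. Differentiation sends a fraction with denominator
  \<open>\<bar>z\<bar>\<^sup>m q\<^sup>n\<close>, where \<open>q = \<eta>1 z\<^sub>1\<^sup>2 + \<eta>2 z\<^sub>2\<^sup>2\<close>, to one with denominator \<open>\<bar>z\<bar>\<close> to the \<open>m + 2\<close> times \<open>q\<close> to the
  \<open>n + 1\<close>; after two steps the operator applied to \<open>K\<close> is a polynomial over \<open>\<bar>z\<bar>\<^sup>5 q\<^sup>5\<close>, and this
  polynomial is \<open>9 \<eta>1 \<eta>2 q\<^sup>5\<close>, while the Laplacian of \<open>1 / \<bar>z\<bar>\<^sup>3\<close> is \<open>9 / \<bar>z\<bar>\<^sup>5\<close>.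

  For uniqueness, the substitution \<open>z = (\<surd>\<eta>2 y\<^sub>1, \<surd>\<eta>1 y\<^sub>2)\<close> turns \<open>\<eta>2 \<partial>\<^sub>1\<^sup>2 + \<eta>1 \<partial>\<^sub>2\<^sup>2\<close> into the
  Laplacian. By homogeneity the difference \<open>u\<close> of two solutions, restricted to the image of the unit
  circle, satisfies \<open>u'' + 9 u = 0\<close> (\<open>second_derivative_along_ellipse\<close>), hence is a combination of
  \<open>cos 3\<theta>\<close> and \<open>sin 3\<theta>\<close>. Such a function changes sign under \<open>\<theta> \<mapsto> \<theta> + \<pi>\<close>, whereas \<open>u\<close> does not because
  the solutions are even; so \<open>u = 0\<close> (\<open>pi_periodic_oscillation_zero\<close>).
\<close>


section \<open>Partial derivatives and smooth functions\<close>

lemma partial_eqI: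
  assumes "((\<lambda>t. f (x + t *\<^sub>R axis i 1)) has_field_derivative D) (at 0)"
  shows "partial i f x = D"
  unfolding partial_def using assms by (rule DERIV_imp_deriv)

text \<open>Openness matters: a line through \<open>x\<close> has to stay in \<open>S\<close> for a while.\<close>

lemma has_partial_transform:
  fixes f g :: "real^'n::finite \<Rightarrow> real"
  assumes "open S" "x \<in> S" and eq: "\<And>y. y \<in> S \<Longrightarrow> f y = g y"
    and D: "((\<lambda>t. f (x + t *\<^sub>R axis i 1)) has_field_derivative D) (at 0)"
  shows "((\<lambda>t. g (x + t *\<^sub>R axis i 1)) has_field_derivative D) (at 0)"
proof (rule has_field_derivative_transform_within_open[OF D])
  show "open ((\<lambda>t. x + t *\<^sub>R axis i 1) -` S)"
    by (intro open_vimage \<open>open S\<close> continuous_intros)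
qed (use assms(2) eq in auto)

lemma C_infinity_on_imp_continuous_on:
  "C_infinity_on f S \<Longrightarrow> continuous_on S f"
  unfolding C_infinity_on_def by (metis C_k_on.simps(1))

lemma C_infinity_on_has_partial:
  assumes "C_infinity_on f S" "x \<in> S"
  shows "((\<lambda>t. f (x + t *\<^sub>R axis i 1)) has_field_derivative partial i f x) (at 0)"
proof -
  have "C_k_on (Suc 0) f S"
    using assms(1) unfolding C_infinity_on_def by blast
  then have "(\<lambda>t. f (x + t *\<^sub>R axis i 1)) field_differentiable (at 0)"
    using assms(2) by simp
  then show ?thesis
    unfolding partial_def by (simp add: DERIV_deriv_iff_field_differentiable)
qed

lemma C_infinity_on_partial:
  assumes "C_infinity_on f S"
  shows "C_infinity_on (partial i f) S"
  unfolding C_infinity_on_def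
proof
  fix k
  have "C_k_on (Suc k) f S"
    using assms unfolding C_infinity_on_def by blast
  then show "C_k_on k (partial i f) S" by simp
qed

text \<open>Smoothness by coinduction: a family of continuous functions that contains the partial
  derivatives of its members consists of smooth functions. On \<open>S\<close> alone the values matter, so the
  induction ranges over all functions that agree on \<open>S\<close> with a member of the family.\<close>

lemma C_infinity_on_if_closed_under_partials:
  fixes F :: "(real^'n::finite \<Rightarrow> real) set"
  assumes S: "open S"
    and cont: "\<And>f. f \<in> F \<Longrightarrow> continuous_on S f"
    and closed: "\<And>f i. f \<in> F \<Longrightarrow>
      \<exists>g\<in>F. \<forall>x\<in>S. ((\<lambda>t. f (x + t *\<^sub>R axis i 1)) has_field_derivative g x) (at 0)"
    and "f \<in> F"
  shows "C_infinity_on f S"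
proof -
  have "C_k_on k g S" if "f \<in> F" "\<And>x. x \<in> S \<Longrightarrow> f x = g x" for k f g
    using that
  proof (induction k arbitrary: f g)
    case 0
    then show ?case using cont by (metis C_k_on.simps(1) continuous_on_cong)
  next
    case (Suc k)
    have "(\<forall>x\<in>S. (\<lambda>t. g (x + t *\<^sub>R axis i 1)) field_differentiable (at 0))
        \<and> C_k_on k (partial i g) S" for i
    proof -
      obtain f' where f': "f' \<in> F"
        "\<And>x. x \<in> S \<Longrightarrow> ((\<lambda>t. f (x + t *\<^sub>R axis i 1)) has_field_derivative f' x) (at 0)"
        using closed[OF Suc.prems(1)] by blast
      have g': "((\<lambda>t. g (x + t *\<^sub>R axis i 1)) has_field_derivative f' x) (at 0)"
        if "x \<in> S" for x
        by (rule has_partial_transform[OF S that _ f'(2)[OF that]]) (rule Suc.prems(2))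
      have "C_k_on k (partial i g) S"
        by (rule Suc.IH[OF f'(1)]) (simp add: partial_eqI[OF g'])
      then show ?thesis using g' field_differentiable_def by blast
    qed
    moreover have "continuous_on S g"
      using cont[OF Suc.prems(1)] Suc.prems(2) by (metis continuous_on_cong)
    ultimately show ?case by simp
  qed
  then show ?thesis using \<open>f \<in> F\<close> unfolding C_infinity_on_def by blast
qed

text \<open>The chain rule along curves needs the total derivative, which exists because the partial
  derivatives are continuous. The criterion \<open>has_derivative_partialsI\<close> is about functions on a
  product space, so the proof transports \<open>f\<close> to pairs of reals and back.\<close>

lemma has_derivative_of_C_infinity_on:
  fixes f :: "real^2 \<Rightarrow> real"
  assumes S: "open S" "x \<in> S" and f: "C_infinity_on f S"
  shows "(f has_derivative (\<lambda>h. h $ 1 * partial 1 f x + h $ 2 * partial 2 f x)) (at x)"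
proof -
  define F where "F = (\<lambda>a b. f (vector [a, b]))"
  define p :: "real^2 \<Rightarrow> real \<times> real" where "p = (\<lambda>y. (y $ 1, y $ 2))"
  define v :: "real \<times> real \<Rightarrow> real^2" where "v = (\<lambda>y. fst y *\<^sub>R axis 1 1 + snd y *\<^sub>R axis 2 1)"
  have v: "v (a, b) = vector [a, b]" for a b
    by (simp add: v_def vec_eq_iff forall_2 axis_def)
  have v_p: "v (p y) = y" for y
    by (simp add: v p_def vec_eq_iff forall_2)
  have cont_v: "continuous_on A v" for A
    unfolding v_def by (intro continuous_intros)
  have "open (v -` S)"
    by (intro open_vimage S cont_v)
  moreover have "p x \<in> v -` S" using S v_p by simp
  ultimately obtain X Y where XY: "open X" "open Y" "p x \<in> X \<times> Y" "X \<times> Y \<subseteq> v -` S"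
    by (rule open_prod_elim)
  obtain e where e: "0 < e" "ball (x $ 2) e \<subseteq> Y"
    using XY by (auto simp: p_def elim: openE)
  let ?Y = "ball (x $ 2) e"
  have mem: "vector [a, b] \<in> S" if "a \<in> X" "b \<in> ?Y" for a b
    using that XY(4) e(2) v by (metis mem_Sigma_iff subsetD vimageD)
  have shift1: "vector [a, b] + t *\<^sub>R axis 1 1 = (vector [t + a, b] :: real^2)" for a b t
    by (simp add: vec_eq_iff forall_2 axis_def)
  have shift2: "vector [a, b] + t *\<^sub>R axis 2 1 = (vector [a, t + b] :: real^2)" for a b t
    by (simp add: vec_eq_iff forall_2 axis_def)
  have D1: "((\<lambda>a. F a b) has_field_derivative partial 1 f (vector [a, b])) (at a)"
    if "a \<in> X" "b \<in> ?Y" for a b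
    using C_infinity_on_has_partial[OF f mem[OF that], of 1]
      DERIV_shift[of "\<lambda>a. F a b" _ 0 a]
    by (simp add: F_def shift1)
  have D2: "((\<lambda>b. F a b) has_field_derivative partial 2 f (vector [a, b])) (at b)"
    if "a \<in> X" "b \<in> ?Y" for a b
    using C_infinity_on_has_partial[OF f mem[OF that], of 2]
      DERIV_shift[of "\<lambda>b. F a b" _ 0 b]
    by (simp add: F_def shift2)
  have in_XY: "x $ 1 \<in> X" "x $ 2 \<in> ?Y" using XY(3) e(1) by (auto simp: p_def)
  have "continuous_on (X \<times> ?Y) (\<lambda>y. blinfun_mult_right (partial 2 f (v y)))"
    using C_infinity_on_imp_continuous_on[OF C_infinity_on_partial[OF f]] mem v
    by (intro bounded_linear.continuous_on[OF bounded_linear_blinfun_mult_right]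
          continuous_on_compose2[OF _ cont_v]) auto
  then have cont: "continuous (at (x $ 1, x $ 2) within X \<times> ?Y)
      (\<lambda>(a, b). blinfun_mult_right (partial 2 f (vector [a, b])))"
    using in_XY by (auto simp: continuous_on_eq_continuous_within split_beta' simp flip: v)
  have "((\<lambda>(a, b). F a b) has_derivative
      (\<lambda>(ta, tb). partial 1 f (v (p x)) * ta + blinfun_mult_right (partial 2 f (vector [x $ 1, x $ 2])) tb))
      (at (x $ 1, x $ 2) within X \<times> ?Y)"
  proof (rule has_derivative_partialsI[OF _ _ cont in_XY(2)])
    show "((\<lambda>a. F a (x $ 2)) has_derivative (*) (partial 1 f (v (p x)))) (at (x $ 1) within X)"
      using D1[OF in_XY] by (simp add: p_def v has_field_derivative_def has_derivative_at_withinI)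
    show "(F a has_derivative blinfun_apply (blinfun_mult_right (partial 2 f (vector [a, b]))))
        (at b within ?Y)" if "a \<in> X" "b \<in> ?Y" for a b
      using D2[OF that] by (simp add: has_field_derivative_def has_derivative_at_withinI)
  qed simp
  then have "((\<lambda>y. F (fst y) (snd y)) has_derivative
      (\<lambda>h. partial 1 f x * fst h + partial 2 f x * snd h)) (at (p x))"
    using at_within_open[of "p x" "X \<times> ?Y"] XY(1) in_XY v v_p[of x]
    by (simp add: split_beta' open_Times p_def)
  moreover have "(p has_derivative p) (at x)"
    unfolding p_def
    by (intro has_derivative_Pair bounded_linear_imp_has_derivative bounded_linear_vec_nth)
  ultimately have "((\<lambda>y. F (fst (p y)) (snd (p y))) has_derivative
      (\<lambda>h. partial 1 f x * fst (p h) + partial 2 f x * snd (p h))) (at x)"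
    using has_derivative_compose by blast
  moreover have "F (fst (p y)) (snd (p y)) = f y" for y
    using v_p[of y] by (simp add: F_def p_def v)
  ultimately show ?thesis by (simp add: p_def mult.commute)
qed


section \<open>Homogeneous functions\<close>

lemma homogeneous_of_orderD:
  "homogeneous_of_order d f \<Longrightarrow> 0 < \<rho> \<Longrightarrow> x \<noteq> 0 \<Longrightarrow> f (\<rho> *\<^sub>R x) = \<rho> powi d * f x"
  unfolding homogeneous_of_order_def by blast

lemma homogeneous_of_order_eq_sgn:
  assumes "homogeneous_of_order d f" "x \<noteq> 0"
  shows "f x = norm x powi d * f (sgn x)"
  using homogeneous_of_orderD[OF assms(1), of "norm x" "sgn x"] assms(2)
  by (simp add: sgn_div_norm)

text \<open>Differentiate \<open>f (\<rho> (x + (t / \<rho>) e\<^sub>i)) = \<rho>\<^sup>d f (x + (t / \<rho>) e\<^sub>i)\<close> in \<open>t\<close> at \<open>0\<close>; the factor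
  \<open>1 / \<rho>\<close> is the loss of one order.\<close>

lemma homogeneous_of_order_partial:
  assumes f: "C_infinity_on f (UNIV - {0})" and hom: "homogeneous_of_order d f"
  shows "homogeneous_of_order (d - 1) (partial i f)"
  unfolding homogeneous_of_order_def
proof (intro allI impI)
  fix \<rho> :: real and x :: "real^2" assume \<rho>: "0 < \<rho>" and x: "x \<noteq> 0"
  let ?l = "\<lambda>t. f (x + t *\<^sub>R axis i 1)"
  have "((\<lambda>t. ?l (t / \<rho>)) has_field_derivative partial i f x * (1 / \<rho>)) (at 0)"
    by (rule DERIV_chain2[of ?l])
       (use C_infinity_on_has_partial[OF f, of x i] x \<rho> in \<open>auto intro!: derivative_eq_intros\<close>)
  then have "((\<lambda>t. \<rho> powi d * ?l (t / \<rho>)) has_field_derivative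
      \<rho> powi d * (partial i f x * (1 / \<rho>))) (at 0)"
    by (rule DERIV_cmult)
  then have "((\<lambda>t. f (\<rho> *\<^sub>R x + t *\<^sub>R axis i 1)) has_field_derivative
      \<rho> powi d * (partial i f x * (1 / \<rho>))) (at 0)"
  proof (rule has_field_derivative_transform_within_open)
    let ?S = "(\<lambda>t. x + (t / \<rho>) *\<^sub>R axis i 1) -` (- {0})"
    show "open ?S" by (intro open_vimage continuous_intros) (use \<rho> in auto)
    show "0 \<in> ?S" using x by simp
    show "\<rho> powi d * ?l (t / \<rho>) = f (\<rho> *\<^sub>R x + t *\<^sub>R axis i 1)" if "t \<in> ?S" for t
      using homogeneous_of_orderD[OF hom \<rho>, of "x + (t / \<rho>) *\<^sub>R axis i 1"] that \<rho>
      by (simp add: scaleR_add_right)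
  qed
  then show "partial i f (\<rho> *\<^sub>R x) = \<rho> powi (d - 1) * partial i f x"
    using \<rho> by (simp add: partial_eqI power_int_diff)
qed

lemma homogeneous_smooth_funpow_partial:
  assumes "C_infinity_on f (UNIV - {0})" "homogeneous_of_order d f"
  shows "C_infinity_on ((partial i ^^ n) f) (UNIV - {0})
    \<and> homogeneous_of_order (d - int n) ((partial i ^^ n) f)"
proof (induction n)
  case (Suc n)
  then show ?case
    using C_infinity_on_partial[of "(partial i ^^ n) f" "UNIV - {0}" i]
      homogeneous_of_order_partial[of "(partial i ^^ n) f" "d - int n" i]
    by (simp add: algebra_simps)
qed (use assms in auto)

lemma homogeneous_monomial_multi_deriv:
  assumes "C_infinity_on f (UNIV - {0})" "homogeneous_of_order d f"
  shows "homogeneous_of_order d (\<lambda>x. monomial a x * multi_deriv a f x)"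
    and "continuous_on (UNIV - {0}) (\<lambda>x. monomial a x * multi_deriv a f x)"
proof -
  have D: "C_infinity_on (multi_deriv a f) (UNIV - {0})"
    "homogeneous_of_order (d - int (fst a + snd a)) (multi_deriv a f)"
    using homogeneous_smooth_funpow_partial[of "(partial 2 ^^ snd a) f" "d - int (snd a)" "fst a" 1]
      homogeneous_smooth_funpow_partial[OF assms, of "snd a" 2]
    unfolding multi_deriv_def by (auto simp: algebra_simps)
  show "continuous_on (UNIV - {0}) (\<lambda>x. monomial a x * multi_deriv a f x)"
    unfolding monomial_def
    by (intro continuous_intros C_infinity_on_imp_continuous_on[OF D(1)])
  show "homogeneous_of_order d (\<lambda>x. monomial a x * multi_deriv a f x)"
    unfolding homogeneous_of_order_def
  proof (intro allI impI)
    fix \<rho> :: real and x :: "real^2" assume \<rho>: "0 < \<rho>" and x: "x \<noteq> 0"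
    let ?n = "fst a + snd a"
    have "\<rho> ^ ?n * \<rho> powi (d - int ?n) = \<rho> powi (int ?n + (d - int ?n))"
      using \<rho> by (subst power_int_add) (simp_all only: power_int_of_nat, simp)
    then have "\<rho> ^ ?n * \<rho> powi (d - int ?n) = \<rho> powi d" by simp
    moreover have "monomial a (\<rho> *\<^sub>R x) = \<rho> ^ ?n * monomial a x"
      by (simp add: monomial_def power_mult_distrib power_add)
    ultimately show "monomial a (\<rho> *\<^sub>R x) * multi_deriv a f (\<rho> *\<^sub>R x)
        = \<rho> powi d * (monomial a x * multi_deriv a f x)"
      using homogeneous_of_orderD[OF D(2) \<rho> x] by (simp only: mult_ac)
  qed
qed

lemma homogeneous_upper_bound:
  fixes f :: "real^2 \<Rightarrow> real"
  assumes "continuous_on (UNIV - {0}) f" "homogeneous_of_order (-3) f"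
  obtains C where "0 < C" "\<And>x. x \<noteq> 0 \<Longrightarrow> \<bar>f x\<bar> < C / norm x ^ 3"
proof -
  have "compact (f ` sphere 0 1)"
    by (intro compact_continuous_image continuous_on_subset[OF assms(1)]) auto
  then obtain M where M: "0 < M" "\<And>x. norm x = 1 \<Longrightarrow> \<bar>f x\<bar> \<le> M"
    by (auto dest!: compact_imp_bounded simp: bounded_pos)
  \<comment> \<open>\<open>M + 1\<close> instead of \<open>M\<close> makes the bound strict.\<close>
  have "\<bar>f x\<bar> < (M + 1) / norm x ^ 3" if "x \<noteq> 0" for x
  proof -
    have "\<bar>f x\<bar> = \<bar>f (sgn x)\<bar> / norm x ^ 3"
      using homogeneous_of_order_eq_sgn[OF assms(2) that]
      by (simp add: abs_mult power_int_minus field_simps)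
    also have "\<dots> < (M + 1) / norm x ^ 3"
      using M(2)[of "sgn x"] that by (intro divide_strict_right_mono) (auto simp: norm_sgn)
    finally show ?thesis .
  qed
  then show thesis using M(1) that[of "M + 1"] by simp
qed

text \<open>The constant is the minimum of \<open>f\<close> on the unit circle, where it is attained and hence
  positive.\<close>

lemma homogeneous_lower_bound:
  fixes f :: "real^2 \<Rightarrow> real"
  assumes "continuous_on (UNIV - {0}) f" "homogeneous_of_order (-3) f"
    and pos: "\<And>x. x \<noteq> 0 \<Longrightarrow> 0 < f x"
  obtains c where "0 < c" "\<And>x. x \<noteq> 0 \<Longrightarrow> c / norm x ^ 3 \<le> f x"
proof -
  have "axis 1 1 \<in> (sphere 0 1 :: (real^2) set)" by (simp add: norm_axis_1)
  then have "\<exists>u\<in>sphere 0 1. \<forall>y\<in>sphere 0 1. f u \<le> f y"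
    by (intro continuous_attains_inf continuous_on_subset[OF assms(1)]) auto
  then obtain u where u: "norm u = 1" "\<And>y. norm y = 1 \<Longrightarrow> f u \<le> f y" by auto
  have "f u / norm x ^ 3 \<le> f x" if "x \<noteq> 0" for x
  proof -
    have "f u / norm x ^ 3 \<le> f (sgn x) / norm x ^ 3"
      using u(2)[of "sgn x"] that by (intro divide_right_mono) (auto simp: norm_sgn)
    also have "\<dots> = f x"
      using homogeneous_of_order_eq_sgn[OF assms(2) that]
      by (simp add: power_int_minus field_simps)
    finally show ?thesis .
  qed
  moreover have "0 < f u" using u(1) by (intro pos) auto
  ultimately show thesis using that by blast
qed

text \<open>Both sides are the derivative of \<open>\<rho> \<mapsto> f (\<rho> x)\<close> at \<open>\<rho> = 1\<close>.\<close>

lemma Euler_homogeneous: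
  assumes f: "C_infinity_on f (UNIV - {0})" and hom: "homogeneous_of_order d f" and x: "x \<noteq> 0"
  shows "x $ 1 * partial 1 f x + x $ 2 * partial 2 f x = of_int d * f x"
proof -
  have "(f has_derivative (\<lambda>h. h $ 1 * partial 1 f x + h $ 2 * partial 2 f x)) (at (1 *\<^sub>R x))"
    using has_derivative_of_C_infinity_on[OF _ _ f] x by (simp add: open_delete)
  moreover have "((\<lambda>\<rho>. \<rho> *\<^sub>R x) has_derivative (\<lambda>h. h *\<^sub>R x)) (at 1)"
    by (auto intro!: derivative_eq_intros)
  ultimately have "((\<lambda>\<rho>. f (\<rho> *\<^sub>R x)) has_derivative
      (\<lambda>h. (h *\<^sub>R x) $ 1 * partial 1 f x + (h *\<^sub>R x) $ 2 * partial 2 f x)) (at 1)"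
    by (rule has_derivative_compose[rotated])
  then have "((\<lambda>\<rho>. f (\<rho> *\<^sub>R x)) has_field_derivative
      x $ 1 * partial 1 f x + x $ 2 * partial 2 f x) (at 1)"
    by (rule has_derivative_imp_has_field_derivative) (simp add: algebra_simps)
  moreover have "((\<lambda>\<rho>. f (\<rho> *\<^sub>R x)) has_field_derivative of_int d * f x) (at 1)"
  proof (rule has_field_derivative_transform_within_open)
    show "((\<lambda>\<rho>. \<rho> powi d * f x) has_field_derivative of_int d * f x) (at 1)"
      by (auto intro!: derivative_eq_intros)
    show "\<rho> powi d * f x = f (\<rho> *\<^sub>R x)" if "\<rho> \<in> {0<..}" for \<rho>
      using homogeneous_of_orderD[OF hom _ x] that by simp
  qed auto
  ultimately show ?thesis by (rule DERIV_unique)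
qed


section \<open>Uniqueness\<close>

definition ellipse :: "real \<Rightarrow> real \<Rightarrow> real \<Rightarrow> real^2" where
  "ellipse \<alpha> \<beta> \<theta> = vector [\<alpha> * cos \<theta>, \<beta> * sin \<theta>]"

lemma ellipse_nonzero:
  assumes "0 < \<alpha>" "0 < \<beta>"
  shows "ellipse \<alpha> \<beta> \<theta> \<noteq> 0"
proof
  assume "ellipse \<alpha> \<beta> \<theta> = 0"
  then have "cos \<theta> = 0" "sin \<theta> = 0"
    using assms by (auto simp: ellipse_def vec_eq_iff forall_2)
  then show False using sin_cos_squared_add[of \<theta>] by simp
qed

text \<open>For \<open>\<alpha> = \<beta> = 1\<close> this is the Laplacian in polar coordinates: on a function homogeneous of order
  \<open>d\<close> it acts on the unit circle as \<open>\<partial>\<^sub>\<theta>\<^sup>2 + d\<^sup>2\<close>. Differentiating twice along the curve gives the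
  Hessian on the tangent minus the radial derivative, and applying Euler's identity to \<open>f\<close> and to
  its first partials gives the Hessian on the position vector; in the sum of the two Hessian terms
  the mixed partials cancel.\<close>

lemma second_derivative_along_ellipse:
  fixes \<alpha> \<beta> :: real
  assumes f: "C_infinity_on f (UNIV - {0})" and hom: "homogeneous_of_order d f"
    and pos: "0 < \<alpha>" "0 < \<beta>"
  defines "p \<equiv> ellipse \<alpha> \<beta>"
  obtains h where
    "\<And>\<theta>. ((\<lambda>\<theta>. f (p \<theta>)) has_field_derivative h \<theta>) (at \<theta>)"
    "\<And>\<theta>. (h has_field_derivative
      \<alpha>\<^sup>2 * multi_deriv (2, 0) f (p \<theta>) + \<beta>\<^sup>2 * multi_deriv (0, 2) f (p \<theta>)
        - of_int (d\<^sup>2) * f (p \<theta>)) (at \<theta>)"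
proof -
  have p1: "p \<theta> $ 1 = \<alpha> * cos \<theta>" and p2: "p \<theta> $ 2 = \<beta> * sin \<theta>" for \<theta>
    by (simp_all add: p_def ellipse_def)
  have p0: "p \<theta> \<noteq> 0" for \<theta>
    unfolding p_def by (rule ellipse_nonzero[OF pos])
  have p': "(p has_derivative (\<lambda>t. t *\<^sub>R vector [- \<alpha> * sin \<theta>, \<beta> * cos \<theta>])) (at \<theta>)" for \<theta>
  proof -
    have "p = (\<lambda>\<theta>. (\<alpha> * cos \<theta>) *\<^sub>R axis 1 1 + (\<beta> * sin \<theta>) *\<^sub>R axis 2 1)"
      by (simp add: p_def ellipse_def vec_eq_iff forall_2 axis_def fun_eq_iff)
    then show ?thesis
      by (auto intro!: derivative_eq_intros simp: vec_eq_iff forall_2 axis_def)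
  qed
  have chain: "((\<lambda>\<theta>. g (p \<theta>)) has_field_derivative
      - \<alpha> * sin \<theta> * partial 1 g (p \<theta>) + \<beta> * cos \<theta> * partial 2 g (p \<theta>)) (at \<theta>)"
    if g: "C_infinity_on g (UNIV - {0})" for g \<theta>
  proof -
    have "(g has_derivative (\<lambda>h. h $ 1 * partial 1 g (p \<theta>) + h $ 2 * partial 2 g (p \<theta>))) (at (p \<theta>))"
      using has_derivative_of_C_infinity_on[OF _ _ g] p0 by (simp add: open_delete)
    from has_derivative_compose[OF p' this] show ?thesis
      by (rule has_derivative_imp_has_field_derivative) (simp add: algebra_simps)
  qed
  define f1 f2 where "f1 = partial 1 f" and "f2 = partial 2 f"
  have f12: "C_infinity_on f1 (UNIV - {0})" "C_infinity_on f2 (UNIV - {0})"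
    "homogeneous_of_order (d - 1) f1" "homogeneous_of_order (d - 1) f2"
    unfolding f1_def f2_def
    by (intro C_infinity_on_partial homogeneous_of_order_partial f hom)+
  define h where "h = (\<lambda>\<theta>. - \<alpha> * sin \<theta> * f1 (p \<theta>) + \<beta> * cos \<theta> * f2 (p \<theta>))"
  have h: "((\<lambda>\<theta>. f (p \<theta>)) has_field_derivative h \<theta>) (at \<theta>)" for \<theta>
    using chain[OF f] by (simp add: h_def f1_def f2_def)
  have "(h has_field_derivative
      \<alpha>\<^sup>2 * multi_deriv (2, 0) f (p \<theta>) + \<beta>\<^sup>2 * multi_deriv (0, 2) f (p \<theta>)
        - of_int (d\<^sup>2) * f (p \<theta>)) (at \<theta>)" for \<theta>
  proof -
    define c s where "c = cos \<theta>" and "s = sin \<theta>"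
    define f11 f12 f21 f22 where "f11 = partial 1 f1 (p \<theta>)" and "f12 = partial 2 f1 (p \<theta>)"
      and "f21 = partial 1 f2 (p \<theta>)" and "f22 = partial 2 f2 (p \<theta>)"
    have multi: "multi_deriv (2, 0) f (p \<theta>) = f11" "multi_deriv (0, 2) f (p \<theta>) = f22"
      by (simp_all add: multi_deriv_def numeral_2_eq_2 f11_def f22_def f1_def f2_def)
    have cs: "c * c + s * s = 1"
      using sin_cos_squared_add2[of \<theta>] by (simp add: c_def s_def power2_eq_square)
    have E: "\<alpha> * c * f1 (p \<theta>) + \<beta> * s * f2 (p \<theta>) = of_int d * f (p \<theta>)"
      "\<alpha> * c * f11 + \<beta> * s * f12 = (of_int d - 1) * f1 (p \<theta>)"
      "\<alpha> * c * f21 + \<beta> * s * f22 = (of_int d - 1) * f2 (p \<theta>)"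
      using Euler_homogeneous[OF f hom p0] Euler_homogeneous[OF f12(1,3) p0]
        Euler_homogeneous[OF f12(2,4) p0]
      by (simp_all add: p1 p2 c_def s_def f11_def f12_def f21_def f22_def f1_def f2_def)
    have "(h has_field_derivative
        - \<alpha> * c * f1 (p \<theta>) - \<beta> * s * f2 (p \<theta>)
        - \<alpha> * s * (- \<alpha> * s * f11 + \<beta> * c * f12)
        + \<beta> * c * (- \<alpha> * s * f21 + \<beta> * c * f22)) (at \<theta>)"
      unfolding h_def c_def s_def f11_def f12_def f21_def f22_def
      by (auto intro!: derivative_eq_intros chain f12 simp: algebra_simps)
    moreover have "- \<alpha> * c * f1 (p \<theta>) - \<beta> * s * f2 (p \<theta>)
        - \<alpha> * s * (- \<alpha> * s * f11 + \<beta> * c * f12) + \<beta> * c * (- \<alpha> * s * f21 + \<beta> * c * f22)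
        = \<alpha>\<^sup>2 * f11 + \<beta>\<^sup>2 * f22 - (of_int d)\<^sup>2 * f (p \<theta>)"
    proof -
      have "\<alpha>\<^sup>2 * c\<^sup>2 * f11 + \<beta>\<^sup>2 * s\<^sup>2 * f22 + \<alpha> * \<beta> * c * s * (f12 + f21)
          = \<alpha> * c * (\<alpha> * c * f11 + \<beta> * s * f12) + \<beta> * s * (\<alpha> * c * f21 + \<beta> * s * f22)"
        by (simp add: algebra_simps power2_eq_square)
      also have "\<dots> = (of_int d - 1) * (\<alpha> * c * f1 (p \<theta>) + \<beta> * s * f2 (p \<theta>))"
        unfolding E(2,3) by (simp add: algebra_simps)
      also have "\<dots> = (of_int d - 1) * (of_int d * f (p \<theta>))"
        unfolding E(1) ..
      finally have radial: "\<alpha>\<^sup>2 * c\<^sup>2 * f11 + \<beta>\<^sup>2 * s\<^sup>2 * f22 + \<alpha> * \<beta> * c * s * (f12 + f21)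
          = (of_int d - 1) * (of_int d * f (p \<theta>))" .
      have "- \<alpha> * c * f1 (p \<theta>) - \<beta> * s * f2 (p \<theta>)
          - \<alpha> * s * (- \<alpha> * s * f11 + \<beta> * c * f12) + \<beta> * c * (- \<alpha> * s * f21 + \<beta> * c * f22)
          = (c * c + s * s) * (\<alpha>\<^sup>2 * f11 + \<beta>\<^sup>2 * f22)
            - (\<alpha> * c * f1 (p \<theta>) + \<beta> * s * f2 (p \<theta>))
            - (\<alpha>\<^sup>2 * c\<^sup>2 * f11 + \<beta>\<^sup>2 * s\<^sup>2 * f22 + \<alpha> * \<beta> * c * s * (f12 + f21))"
        by (simp add: algebra_simps power2_eq_square)
      also have "\<dots> = \<alpha>\<^sup>2 * f11 + \<beta>\<^sup>2 * f22 - (of_int d)\<^sup>2 * f (p \<theta>)"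
        unfolding cs E(1) radial by (simp add: algebra_simps power2_eq_square)
      finally show ?thesis .
    qed
    ultimately show ?thesis by (simp add: multi)
  qed
  with h show thesis by (rule that)
qed

text \<open>The coefficients \<open>a\<close> and \<open>b\<close> of \<open>u = a cos 3\<theta> + b sin 3\<theta>\<close>, found by variation of constants,
  are constant. So \<open>u\<close> is antiperiodic with respect to \<open>\<pi>\<close> as well as periodic.\<close>

lemma pi_periodic_oscillation_zero:
  fixes u :: "real \<Rightarrow> real"
  assumes u: "\<And>\<theta>. (u has_field_derivative u' \<theta>) (at \<theta>)"
    and u': "\<And>\<theta>. (u' has_field_derivative - 9 * u \<theta>) (at \<theta>)"
    and per: "\<And>\<theta>. u (\<theta> + pi) = u \<theta>"
  shows "u \<theta> = 0"
proof -
  define a where "a = (\<lambda>\<theta>. u \<theta> * cos (3 * \<theta>) - u' \<theta> / 3 * sin (3 * \<theta>))"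
  define b where "b = (\<lambda>\<theta>. u \<theta> * sin (3 * \<theta>) + u' \<theta> / 3 * cos (3 * \<theta>))"
  have "(a has_field_derivative 0) (at \<theta>)" "(b has_field_derivative 0) (at \<theta>)" for \<theta>
    unfolding a_def b_def
    by (auto intro!: derivative_eq_intros u u' simp: field_simps)
  then have const: "a (\<theta> + pi) = a \<theta>" "b (\<theta> + pi) = b \<theta>"
    by (metis DERIV_isconst_all)+
  have ab: "u \<theta> = a \<theta> * cos (3 * \<theta>) + b \<theta> * sin (3 * \<theta>)" for \<theta>
  proof -
    have "(v * c - w * s) * c + (v * s + w * c) * s = v * (c * c + s * s)" for v w c s :: real
      by (simp add: algebra_simps)
    then have "a \<theta> * cos (3 * \<theta>) + b \<theta> * sin (3 * \<theta>)
        = u \<theta> * (cos (3 * \<theta>) * cos (3 * \<theta>) + sin (3 * \<theta>) * sin (3 * \<theta>))"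
      unfolding a_def b_def by blast
    also have "\<dots> = u \<theta>"
      using sin_cos_squared_add3[of "3 * \<theta>"] by (simp only: mult_1_right)
    finally show ?thesis ..
  qed
  have "cos (3 * (\<theta> + pi)) = - cos (3 * \<theta>)" "sin (3 * (\<theta> + pi)) = - sin (3 * \<theta>)"
    using cos_periodic_pi[of "3 * \<theta> + 2 * pi"] sin_periodic_pi[of "3 * \<theta> + 2 * pi"]
      cos_periodic[of "3 * \<theta>"] sin_periodic[of "3 * \<theta>"]
    by (simp_all add: algebra_simps)
  then have "u (\<theta> + pi) = - u \<theta>"
    using ab[of \<theta>] ab[of "\<theta> + pi"] const by simp
  then show ?thesis using per[of \<theta>] by simp
qed

text \<open>By homogeneity a solution is determined by its values on the ellipse with semi-axes \<open>\<surd>\<eta>2\<close>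
  and \<open>\<surd>\<eta>1\<close>, which meets every ray from the origin. These semi-axes are the ones for which
  \<open>second_derivative_along_ellipse\<close> involves exactly the operator of the equation.\<close>

lemma homogeneous_kernel_equation_unique:
  assumes pos: "0 < \<eta>1" "0 < \<eta>2"
    and f: "admissible_solution \<eta>1 \<eta>2 f" and g: "admissible_solution \<eta>1 \<eta>2 g"
    and x: "x \<noteq> 0"
  shows "f x = g x"
proof -
  define \<alpha> \<beta> where "\<alpha> = sqrt \<eta>2" and "\<beta> = sqrt \<eta>1"
  have \<alpha>\<beta>: "0 < \<alpha>" "0 < \<beta>" "\<alpha>\<^sup>2 = \<eta>2" "\<beta>\<^sup>2 = \<eta>1"
    using pos by (simp_all add: \<alpha>_def \<beta>_def)
  define p where "p = ellipse \<alpha> \<beta>"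
  have f': "C_infinity_on f (UNIV - {0})" "homogeneous_of_order (-3) f" "even_function f"
    "solves_kernel_pde \<eta>1 \<eta>2 f"
    and g': "C_infinity_on g (UNIV - {0})" "homogeneous_of_order (-3) g" "even_function g"
    "solves_kernel_pde \<eta>1 \<eta>2 g"
    using f g unfolding admissible_solution_def by auto
  have p0: "p \<theta> \<noteq> 0" for \<theta>
    unfolding p_def by (rule ellipse_nonzero[OF \<alpha>\<beta>(1,2)])
  obtain F where F: "\<And>\<theta>. ((\<lambda>\<theta>. f (p \<theta>)) has_field_derivative F \<theta>) (at \<theta>)"
    "\<And>\<theta>. (F has_field_derivative
      \<alpha>\<^sup>2 * multi_deriv (2, 0) f (p \<theta>) + \<beta>\<^sup>2 * multi_deriv (0, 2) f (p \<theta>)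
        - of_int ((-3)\<^sup>2) * f (p \<theta>)) (at \<theta>)"
    using second_derivative_along_ellipse[OF f'(1,2) \<alpha>\<beta>(1,2)] unfolding p_def by blast
  obtain G where G: "\<And>\<theta>. ((\<lambda>\<theta>. g (p \<theta>)) has_field_derivative G \<theta>) (at \<theta>)"
    "\<And>\<theta>. (G has_field_derivative
      \<alpha>\<^sup>2 * multi_deriv (2, 0) g (p \<theta>) + \<beta>\<^sup>2 * multi_deriv (0, 2) g (p \<theta>)
        - of_int ((-3)\<^sup>2) * g (p \<theta>)) (at \<theta>)"
    using second_derivative_along_ellipse[OF g'(1,2) \<alpha>\<beta>(1,2)] unfolding p_def by blast
  have same: "\<alpha>\<^sup>2 * multi_deriv (2, 0) f (p \<theta>) + \<beta>\<^sup>2 * multi_deriv (0, 2) f (p \<theta>)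
      = \<alpha>\<^sup>2 * multi_deriv (2, 0) g (p \<theta>) + \<beta>\<^sup>2 * multi_deriv (0, 2) g (p \<theta>)" for \<theta>
    using f'(4) g'(4) p0[of \<theta>] unfolding solves_kernel_pde_def \<alpha>\<beta>(3,4) by simp
  have eq: "f (p \<theta>) - g (p \<theta>) = 0" for \<theta>
  proof (rule pi_periodic_oscillation_zero[where u = "\<lambda>\<theta>. f (p \<theta>) - g (p \<theta>)"
        and u' = "\<lambda>\<theta>. F \<theta> - G \<theta>"])
    show "((\<lambda>\<theta>. f (p \<theta>) - g (p \<theta>)) has_field_derivative F \<theta> - G \<theta>) (at \<theta>)" for \<theta>
      by (intro DERIV_diff F G)
    show "((\<lambda>\<theta>. F \<theta> - G \<theta>) has_field_derivative - 9 * (f (p \<theta>) - g (p \<theta>))) (at \<theta>)" for \<theta>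
      using DERIV_diff[OF F(2) G(2), of \<theta>] same[of \<theta>] by (simp add: algebra_simps)
    have "p (\<theta> + pi) = - p \<theta>" for \<theta>
      by (simp add: p_def ellipse_def vec_eq_iff forall_2)
    then show "f (p (\<theta> + pi)) - g (p (\<theta> + pi)) = f (p \<theta>) - g (p \<theta>)" for \<theta>
      using f'(3) g'(3) p0[of \<theta>] unfolding even_function_def by metis
  qed
  define y1 y2 where "y1 = x $ 1 / \<alpha>" and "y2 = x $ 2 / \<beta>"
  define \<rho> where "\<rho> = sqrt (y1\<^sup>2 + y2\<^sup>2)"
  have "y1 \<noteq> 0 \<or> y2 \<noteq> 0"
    using x \<alpha>\<beta> by (auto simp: y1_def y2_def vec_eq_iff forall_2)
  then have \<rho>: "0 < \<rho>" unfolding \<rho>_def by (metis real_sqrt_gt_0_iff sum_power2_gt_zero_iff)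
  have "(y1 / \<rho>)\<^sup>2 + (y2 / \<rho>)\<^sup>2 = (y1\<^sup>2 + y2\<^sup>2) / \<rho>\<^sup>2"
    by (simp add: power_divide add_divide_distrib)
  also have "y1\<^sup>2 + y2\<^sup>2 = \<rho>\<^sup>2"
    by (simp add: \<rho>_def)
  also have "\<rho>\<^sup>2 / \<rho>\<^sup>2 = 1"
    using \<rho> by simp
  finally obtain \<theta> where \<theta>: "y1 / \<rho> = cos \<theta>" "y2 / \<rho> = sin \<theta>"
    using sincos_total_2pi by blast
  have "x $ 1 = \<rho> * (\<alpha> * (y1 / \<rho>))" "x $ 2 = \<rho> * (\<beta> * (y2 / \<rho>))"
    using \<rho> \<alpha>\<beta> by (simp_all add: y1_def y2_def)
  then have "x = \<rho> *\<^sub>R p \<theta>"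
    by (simp add: p_def ellipse_def vec_eq_iff forall_2 \<theta>)
  then show ?thesis
    using eq[of \<theta>] homogeneous_of_orderD[OF f'(2) \<rho> p0] homogeneous_of_orderD[OF g'(2) \<rho> p0] by simp
qed


section \<open>The kernel\<close>

definition quad :: "real \<Rightarrow> real \<Rightarrow> real^2 \<Rightarrow> real" where
  "quad a b z = a * (z $ 1)\<^sup>2 + b * (z $ 2)\<^sup>2"

lemma quad_pos:
  assumes "0 < a" "0 < b" "z \<noteq> 0"
  shows "0 < quad a b z"
proof -
  have "z $ 1 \<noteq> 0 \<or> z $ 2 \<noteq> 0" using assms(3) by (auto simp: vec_eq_iff forall_2)
  then show ?thesis
    using assms(1,2) unfolding quad_def
    by (elim disjE) (simp_all add: add_pos_nonneg add_nonneg_pos)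
qed

lemma norm_square_eq: "(norm (z :: real^2))\<^sup>2 = (z $ 1)\<^sup>2 + (z $ 2)\<^sup>2"
  by (simp add: norm_vec_def L2_set_def sum_2)

lemma has_partial_coord:
  "((\<lambda>t. (z + t *\<^sub>R axis i 1) $ j) has_field_derivative (axis i 1 :: real^'n::finite) $ j) (at 0)"
  by (auto intro!: derivative_eq_intros)

lemma has_partial_quad:
  "((\<lambda>t. quad a b (z + t *\<^sub>R axis i 1)) has_field_derivative
    2 * (a * z $ 1 * axis i 1 $ 1 + b * z $ 2 * axis i 1 $ 2)) (at 0)"
  unfolding quad_def by (auto intro!: derivative_eq_intros)

lemma has_partial_norm:
  fixes z :: "real^2"
  assumes "z \<noteq> 0"
  shows "((\<lambda>t. norm (z + t *\<^sub>R axis i 1)) has_field_derivative z $ i / norm z) (at 0)"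
proof -
  have n: "norm y = sqrt (quad 1 1 y)" for y
    unfolding quad_def mult_1_left norm_square_eq[symmetric] by simp
  have "0 < quad 1 1 (z + 0 *\<^sub>R axis i 1)" using quad_pos[of 1 1 z] assms by simp
  from DERIV_chain2[where g = "\<lambda>t. quad 1 1 (z + t *\<^sub>R axis i 1)",
      OF DERIV_real_sqrt[OF this] has_partial_quad]
  have "((\<lambda>t. norm (z + t *\<^sub>R axis i 1)) has_field_derivative
      inverse (norm z) / 2 * (2 * (z $ 1 * axis i 1 $ 1 + z $ 2 * axis i 1 $ 2))) (at 0)"
    unfolding n by simp
  moreover have "z $ 1 * axis i 1 $ 1 + z $ 2 * axis i 1 $ 2 = z $ i"
    using exhaust_2[of i] by (elim disjE) (simp_all add: axis_def)
  then have "inverse (norm z) / 2 * (2 * (z $ 1 * axis i 1 $ 1 + z $ 2 * axis i 1 $ 2))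
      = z $ i / norm z"
    by (simp only:) (simp add: field_simps)
  ultimately show ?thesis by (rule DERIV_cong)
qed

text \<open>The ring generated by the ingredients of the kernel; it is closed under partial derivatives
  because \<open>\<partial>\<^sub>i (1 / \<bar>z\<bar>) = - z\<^sub>i / \<bar>z\<bar>\<^sup>3\<close> and \<open>\<partial>\<^sub>i (1 / q) = - \<partial>\<^sub>i q / q\<^sup>2\<close>.\<close>

inductive_set smooth_fractions :: "real \<Rightarrow> real \<Rightarrow> (real^2 \<Rightarrow> real) set" for a b where
  const: "(\<lambda>z. c) \<in> smooth_fractions a b"
| coord: "(\<lambda>z. z $ j) \<in> smooth_fractions a b"
| inv_norm: "(\<lambda>z. 1 / norm z) \<in> smooth_fractions a b"
| inv_quad: "(\<lambda>z. 1 / quad a b z) \<in> smooth_fractions a b"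
| add: "f \<in> smooth_fractions a b \<Longrightarrow> g \<in> smooth_fractions a b \<Longrightarrow> (\<lambda>z. f z + g z) \<in> smooth_fractions a b"
| mult: "f \<in> smooth_fractions a b \<Longrightarrow> g \<in> smooth_fractions a b \<Longrightarrow> (\<lambda>z. f z * g z) \<in> smooth_fractions a b"

lemma smooth_fractions_power:
  "f \<in> smooth_fractions a b \<Longrightarrow> (\<lambda>z. f z ^ n) \<in> smooth_fractions a b"
  by (induction n) (auto intro: smooth_fractions.intros)

lemma smooth_fractions_continuous:
  assumes "0 < a" "0 < b" "f \<in> smooth_fractions a b"
  shows "continuous_on (UNIV - {0}) f"
  using assms(3)
proof induction
  case inv_quad
  have "quad a b z \<noteq> 0" if "z \<noteq> 0" for z
    using quad_pos[OF assms(1,2) that] by simp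
  then show ?case
    by (auto simp: quad_def intro!: continuous_intros)
qed (auto intro!: continuous_intros)

lemma smooth_fractions_partial:
  assumes pos: "0 < a" "0 < b" and "f \<in> smooth_fractions a b"
  shows "\<exists>g\<in>smooth_fractions a b. \<forall>z\<in>UNIV - {0}.
    ((\<lambda>t. f (z + t *\<^sub>R axis i 1)) has_field_derivative g z) (at 0)"
  using assms(3)
proof induction
  case (const c)
  show ?case by (intro bexI[of _ "\<lambda>z. 0"] ballI DERIV_const smooth_fractions.const)
next
  case (coord j)
  show ?case
    by (intro bexI[of _ "\<lambda>z. axis i 1 $ j"] ballI has_partial_coord smooth_fractions.const)
next
  case inv_norm
  let ?g = "\<lambda>z::real^2. - 1 * z $ i * (1 / norm z) ^ 3"
  have "((\<lambda>t. 1 / norm (z + t *\<^sub>R axis i 1)) has_field_derivative ?g z) (at 0)" if "z \<in> UNIV - {0}" for z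
    by (rule DERIV_cong[OF DERIV_divide[OF DERIV_const has_partial_norm]])
       (use that in \<open>simp_all add: power3_eq_cube\<close>)
  moreover have "?g \<in> smooth_fractions a b"
    by (intro smooth_fractions.intros smooth_fractions_power)
  ultimately show ?case by (intro bexI[where x = ?g] ballI)
next
  case inv_quad
  let ?g = "\<lambda>z::real^2. - 2 * (a * z $ 1 * axis i 1 $ 1 + b * z $ 2 * axis i 1 $ 2) * (1 / quad a b z) ^ 2"
  have "((\<lambda>t. 1 / quad a b (z + t *\<^sub>R axis i 1)) has_field_derivative ?g z) (at 0)" if "z \<in> UNIV - {0}" for z
    by (rule DERIV_cong[OF DERIV_divide[OF DERIV_const has_partial_quad]])
       (use quad_pos[OF pos, of z] that in \<open>simp_all add: power2_eq_square\<close>)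
  moreover have "?g \<in> smooth_fractions a b"
    by (intro smooth_fractions.intros smooth_fractions_power)
  ultimately show ?case by (intro bexI[where x = ?g] ballI)
next
  case (add f g)
  then obtain f' g' where f'g': "f' \<in> smooth_fractions a b" "g' \<in> smooth_fractions a b"
    and f': "\<And>z. z \<in> UNIV - {0} \<Longrightarrow> ((\<lambda>t. f (z + t *\<^sub>R axis i 1)) has_field_derivative f' z) (at 0)"
    and g': "\<And>z. z \<in> UNIV - {0} \<Longrightarrow> ((\<lambda>t. g (z + t *\<^sub>R axis i 1)) has_field_derivative g' z) (at 0)"
    by blast
  then show ?case
    by (intro bexI[of _ "\<lambda>z. f' z + g' z"] ballI DERIV_add f' g' smooth_fractions.add f'g')
next
  case (mult f g)
  then obtain f' g' where f'g': "f' \<in> smooth_fractions a b" "g' \<in> smooth_fractions a b"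
    and f': "\<And>z. z \<in> UNIV - {0} \<Longrightarrow> ((\<lambda>t. f (z + t *\<^sub>R axis i 1)) has_field_derivative f' z) (at 0)"
    and g': "\<And>z. z \<in> UNIV - {0} \<Longrightarrow> ((\<lambda>t. g (z + t *\<^sub>R axis i 1)) has_field_derivative g' z) (at 0)"
    by blast
  have "((\<lambda>t. f (z + t *\<^sub>R axis i 1) * g (z + t *\<^sub>R axis i 1))
      has_field_derivative f' z * g z + g' z * f z) (at 0)" if "z \<in> UNIV - {0}" for z
    using DERIV_mult[OF f'[OF that] g'[OF that]] by simp
  moreover have "(\<lambda>z. f' z * g z + g' z * f z) \<in> smooth_fractions a b"
    by (intro smooth_fractions.add smooth_fractions.mult mult(1,2) f'g')
  ultimately show ?case by (intro bexI[where x = "\<lambda>z. f' z * g z + g' z * f z"] ballI)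
qed

text \<open>The exponent \<open>1\<close> is kept so that \<open>has_partial_over_norm_quad\<close> applies.\<close>

lemma kernel_eq:
  "kernel a b z = a * b * ((3 * a\<^sup>2 - 2 * a * b) * (z $ 1) ^ 4
      + 2 * (3 * a\<^sup>2 - 5 * a * b + 3 * b\<^sup>2) * (z $ 1)\<^sup>2 * (z $ 2)\<^sup>2
      + (3 * b\<^sup>2 - 2 * a * b) * (z $ 2) ^ 4) / (norm z ^ 1 * quad a b z ^ 3)"
  by (simp add: kernel_def quad_def)

lemma C_infinity_on_kernel:
  assumes "0 < a" "0 < b"
  shows "C_infinity_on (kernel a b) (UNIV - {0})"
proof (rule C_infinity_on_if_closed_under_partials[where F = "smooth_fractions a b"])
  have "kernel a b = (\<lambda>z. a * b * ((3 * a\<^sup>2 - 2 * a * b) * (z $ 1) ^ 4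
      + 2 * (3 * a\<^sup>2 - 5 * a * b + 3 * b\<^sup>2) * (z $ 1)\<^sup>2 * (z $ 2)\<^sup>2
      + (3 * b\<^sup>2 - 2 * a * b) * (z $ 2) ^ 4) * (1 / norm z) * (1 / quad a b z) ^ 3)"
    by (simp add: fun_eq_iff kernel_eq power_divide)
  then show "kernel a b \<in> smooth_fractions a b"
    by (simp only:) (intro smooth_fractions.intros smooth_fractions_power)
qed (use assms smooth_fractions_continuous smooth_fractions_partial in \<open>auto simp: open_delete\<close>)

lemma kernel_even: "even_function (kernel a b)"
  by (simp add: even_function_def kernel_def)

lemma kernel_homogeneous: "homogeneous_of_order (-3) (kernel a b)"
  unfolding homogeneous_of_order_def
proof (intro allI impI)
  fix \<rho> :: real and x :: "real^2" assume \<rho>: "0 < \<rho>"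
  define N where "N = (\<lambda>z::real^2. a * b * ((3 * a\<^sup>2 - 2 * a * b) * (z $ 1) ^ 4
      + 2 * (3 * a\<^sup>2 - 5 * a * b + 3 * b\<^sup>2) * (z $ 1)\<^sup>2 * (z $ 2)\<^sup>2
      + (3 * b\<^sup>2 - 2 * a * b) * (z $ 2) ^ 4))"
  have K: "kernel a b z = N z / (norm z ^ 1 * quad a b z ^ 3)" for z
    unfolding kernel_eq N_def ..
  have "N (\<rho> *\<^sub>R x) = \<rho> ^ 4 * N x"
  proof -
    have "\<rho> ^ 4 = \<rho>\<^sup>2 * \<rho>\<^sup>2" by (simp flip: power_add)
    then show ?thesis
      unfolding N_def by (simp add: power_mult_distrib distrib_left mult_ac)
  qed
  moreover have "quad a b (\<rho> *\<^sub>R x) = \<rho>\<^sup>2 * quad a b x"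
    unfolding quad_def by (simp add: power_mult_distrib algebra_simps)
  moreover have "\<rho> powi -3 = \<rho> ^ 4 / (\<rho> * (\<rho>\<^sup>2) ^ 3)"
    using \<rho> by (simp add: power_int_minus eval_nat_numeral field_simps)
  ultimately show "kernel a b (\<rho> *\<^sub>R x) = \<rho> powi -3 * kernel a b x"
    using \<rho> unfolding K by (simp add: power_mult_distrib)
qed

text \<open>The quotient rule, with \<open>\<partial>\<^sub>i \<bar>z\<bar>\<^sup>m = m z\<^sub>i \<bar>z\<bar>\<^sup>m / \<bar>z\<bar>\<^sup>2\<close>. A common denominator is fixed in advance,
  so that repeated differentiation acts on polynomial numerators only.\<close>

lemma has_partial_over_norm_quad:
  assumes pos: "0 < a" "0 < b" and z: "z \<noteq> 0"
    and P: "((\<lambda>t. P (z + t *\<^sub>R axis i 1)) has_field_derivative P') (at 0)"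
  shows "((\<lambda>t. P (z + t *\<^sub>R axis i 1)
        / (norm (z + t *\<^sub>R axis i 1) ^ m * quad a b (z + t *\<^sub>R axis i 1) ^ n))
    has_field_derivative
      (P' * (norm z)\<^sup>2 * quad a b z - real m * z $ i * P z * quad a b z
        - real n * (2 * (a * z $ 1 * axis i 1 $ 1 + b * z $ 2 * axis i 1 $ 2)) * P z * (norm z)\<^sup>2)
      / (norm z ^ (m + 2) * quad a b z ^ (n + 1))) (at 0)"
proof -
  \<comment> \<open>Dividing by \<open>g 0\<close> avoids the truncated exponent \<open>k - 1\<close> of the usual power rule.\<close>
  have power: "((\<lambda>t. g t ^ k) has_field_derivative real k * g' * g 0 ^ k / g 0) (at 0)"
    if "(g has_field_derivative g') (at 0)" "g 0 \<noteq> 0" for g :: "real \<Rightarrow> real" and g' k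
    using DERIV_power[OF that(1), of k] that(2) by (cases k) (simp_all add: mult_ac)
  have q: "quad a b z \<noteq> 0" using quad_pos[OF pos z] by simp
  show ?thesis
    by (rule DERIV_cong[OF DERIV_divide[OF P DERIV_mult[OF
            power[OF has_partial_norm[OF z]] power[OF has_partial_quad]]]])
       (use z q in \<open>simp_all add: field_simps power2_eq_square\<close>)
qed

lemma second_partial_eqI:
  assumes "\<And>y. y \<noteq> 0 \<Longrightarrow> ((\<lambda>t. f (y + t *\<^sub>R axis i 1)) has_field_derivative f' y) (at 0)"
    and "((\<lambda>t. f' (z + t *\<^sub>R axis i 1)) has_field_derivative D) (at 0)" and "z \<noteq> 0"
  shows "partial i (partial i f) z = D"
proof (rule partial_eqI, rule has_partial_transform[OF _ _ _ assms(2)])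
  show "f' y = partial i f y" if "y \<in> UNIV - {0}" for y
    using partial_eqI[OF assms(1)[of y]] that by simp
qed (use assms(3) in \<open>auto simp: open_delete\<close>)

text \<open>In the plane \<open>\<Delta> \<bar>z\<bar>\<^sup>d = d\<^sup>2 \<bar>z\<bar>\<^sup>d / \<bar>z\<bar>\<^sup>2\<close>, here with \<open>d = -3\<close>.\<close>

lemma laplacian_norm_minus_3:
  fixes z :: "real^2"
  assumes z: "z \<noteq> 0"
  shows "multi_deriv (2, 0) (\<lambda>w. 1 / norm w ^ 3) z + multi_deriv (0, 2) (\<lambda>w. 1 / norm w ^ 3) z
    = 9 / norm z ^ 5"
proof -
  let ?f = "\<lambda>w::real^2. 1 / norm w ^ 3"
  have "partial i (partial i ?f) z = (15 * (z $ i)\<^sup>2 - 3 * (norm z)\<^sup>2) / norm z ^ 7" for i :: 2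
  proof (rule second_partial_eqI[OF _ _ z])
    have q: "quad 1 1 y \<noteq> 0" if "y \<noteq> 0" for y :: "real^2" using quad_pos[of 1 1 y] that by simp
    show "((\<lambda>t. ?f (y + t *\<^sub>R axis i 1)) has_field_derivative
        (- 3 * y $ i) / (norm y ^ 5 * quad 1 1 y ^ 0)) (at 0)"
      if "y \<noteq> 0" for y
      using has_partial_over_norm_quad[of 1 1 y "\<lambda>y. 1" i 0 3 0] that q[OF that] by simp
    have "((\<lambda>t. - 3 * (z + t *\<^sub>R axis i 1) $ i) has_field_derivative - 3) (at 0)"
      by (auto intro!: derivative_eq_intros)
    from has_partial_over_norm_quad[OF zero_less_one zero_less_one z this, of 5 0]
    show "((\<lambda>t. (- 3 * (z + t *\<^sub>R axis i 1) $ i)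
          / (norm (z + t *\<^sub>R axis i 1) ^ 5 * quad 1 1 (z + t *\<^sub>R axis i 1) ^ 0))
        has_field_derivative (15 * (z $ i)\<^sup>2 - 3 * (norm z)\<^sup>2) / norm z ^ 7) (at 0)"
      by (rule DERIV_cong) (use q[OF z] z in \<open>simp add: power2_eq_square field_simps\<close>)
  qed
  then have "multi_deriv (2, 0) ?f z + multi_deriv (0, 2) ?f z
      = (15 * ((z $ 1)\<^sup>2 + (z $ 2)\<^sup>2) - 6 * (norm z)\<^sup>2) / norm z ^ 7"
    by (simp add: multi_deriv_def numeral_2_eq_2 add_divide_distrib diff_divide_distrib)
  also have "\<dots> = 9 * (norm z)\<^sup>2 / norm z ^ (5 + 2)"
    by (simp flip: norm_square_eq)
  also have "\<dots> = 9 / norm z ^ 5"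
    unfolding power_add using z by (intro nonzero_mult_divide_mult_cancel_right) simp
  finally show ?thesis .
qed

text \<open>Here \<open>N\<close> is the numerator of the kernel, and \<open>N / (\<bar>z\<bar> q\<^sup>3)\<close> differentiates to
  \<open>M1 / (\<bar>z\<bar>\<^sup>3 q\<^sup>4)\<close> in the first and to \<open>M2 / (\<bar>z\<bar>\<^sup>3 q\<^sup>4)\<close> in the second variable. With \<open>M11 = \<partial>\<^sub>1 M1\<close> and
  \<open>M22 = \<partial>\<^sub>2 M2\<close>, the equation becomes a polynomial identity over \<open>\<bar>z\<bar>\<^sup>5 q\<^sup>5\<close>.\<close>

lemma kernel_solves_pde:
  assumes pos: "0 < a" "0 < b"
  shows "solves_kernel_pde a b (kernel a b)"
  unfolding solves_kernel_pde_def
proof (intro allI impI)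
  fix z :: "real^2" assume z: "z \<noteq> 0"
  define A B C where "A = 3 * a\<^sup>2 - 2 * a * b" and "B = 2 * (3 * a\<^sup>2 - 5 * a * b + 3 * b\<^sup>2)"
    and "C = 3 * b\<^sup>2 - 2 * a * b"
  define N where "N = (\<lambda>x y. a * b * (A * x ^ 4 + B * x\<^sup>2 * y\<^sup>2 + C * y ^ 4))"
  define N1 where "N1 = (\<lambda>x y. a * b * (4 * A * x ^ 3 + 2 * B * x * y\<^sup>2))"
  define N2 where "N2 = (\<lambda>x y. a * b * (2 * B * x\<^sup>2 * y + 4 * C * y ^ 3))"
  define s where "s = (\<lambda>x y :: real. x\<^sup>2 + y\<^sup>2)"
  define q where "q = (\<lambda>x y :: real. a * x\<^sup>2 + b * y\<^sup>2)"
  define M1 where "M1 = (\<lambda>x y. N1 x y * s x y * q x y - x * N x y * q x y - 6 * a * x * N x y * s x y)"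
  define M2 where "M2 = (\<lambda>x y. N2 x y * s x y * q x y - y * N x y * q x y - 6 * b * y * N x y * s x y)"
  define M11 where "M11 = (\<lambda>x y. a * b * (12 * A * x\<^sup>2 + 2 * B * y\<^sup>2) * s x y * q x y
    + N1 x y * (2 * x) * q x y + N1 x y * s x y * (2 * a * x)
    - (N x y * q x y + x * N1 x y * q x y + x * N x y * (2 * a * x))
    - 6 * a * (N x y * s x y + x * N1 x y * s x y + x * N x y * (2 * x)))"
  define M22 where "M22 = (\<lambda>x y. a * b * (2 * B * x\<^sup>2 + 12 * C * y\<^sup>2) * s x y * q x y
    + N2 x y * (2 * y) * q x y + N2 x y * s x y * (2 * b * y)
    - (N x y * q x y + y * N2 x y * q x y + y * N x y * (2 * b * y))
    - 6 * b * (N x y * s x y + y * N2 x y * s x y + y * N x y * (2 * y)))"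
  have dN: "((\<lambda>x. N x y) has_field_derivative N1 x y) (at x)"
    "((\<lambda>y. N x y) has_field_derivative N2 x y) (at y)" for x y
    unfolding N_def N1_def N2_def by (auto intro!: derivative_eq_intros simp: algebra_simps)
  have dN1: "((\<lambda>x. N1 x y) has_field_derivative a * b * (12 * A * x\<^sup>2 + 2 * B * y\<^sup>2)) (at x)"
    and dN2: "((\<lambda>y. N2 x y) has_field_derivative a * b * (2 * B * x\<^sup>2 + 12 * C * y\<^sup>2)) (at y)" for x y
    unfolding N1_def N2_def by (auto intro!: derivative_eq_intros simp: algebra_simps)
  have ds: "((\<lambda>x. s x y) has_field_derivative 2 * x) (at x)"
    "((\<lambda>y. s x y) has_field_derivative 2 * y) (at y)" for x y
    unfolding s_def by (auto intro!: derivative_eq_intros)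
  have dq: "((\<lambda>x. q x y) has_field_derivative 2 * a * x) (at x)"
    "((\<lambda>y. q x y) has_field_derivative 2 * b * y) (at y)" for x y
    unfolding q_def by (auto intro!: derivative_eq_intros)
  have dM: "((\<lambda>x. M1 x y) has_field_derivative M11 x y) (at x)"
    "((\<lambda>y. M2 x y) has_field_derivative M22 x y) (at y)" for x y
    unfolding M1_def M2_def M11_def M22_def
    by (rule derivative_eq_intros dN dN1 dN2 ds dq refl | simp add: algebra_simps)+
  have along1: "((\<lambda>t. g ((y + t *\<^sub>R axis 1 1) $ 1) ((y + t *\<^sub>R axis 1 1) $ 2)) has_field_derivative g') (at 0)"
    if "((\<lambda>x. g x (y $ 2)) has_field_derivative g') (at (y $ 1))"
    for g :: "real \<Rightarrow> real \<Rightarrow> real" and g' and y :: "real^2"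
    using that DERIV_shift[of "\<lambda>x. g x (y $ 2)" g' 0 "y $ 1"]
    by (simp add: axis_def add.commute)
  have along2: "((\<lambda>t. g ((y + t *\<^sub>R axis 2 1) $ 1) ((y + t *\<^sub>R axis 2 1) $ 2)) has_field_derivative g') (at 0)"
    if "((\<lambda>x. g (y $ 1) x) has_field_derivative g') (at (y $ 2))"
    for g :: "real \<Rightarrow> real \<Rightarrow> real" and g' and y :: "real^2"
    using that DERIV_shift[of "\<lambda>x. g (y $ 1) x" g' 0 "y $ 2"]
    by (simp add: axis_def add.commute)
  have sq: "(norm y)\<^sup>2 = s (y $ 1) (y $ 2)" "quad a b y = q (y $ 1) (y $ 2)" for y
    by (simp_all add: norm_square_eq quad_def s_def q_def)
  have K: "kernel a b = (\<lambda>y. N (y $ 1) (y $ 2) / (norm y ^ 1 * quad a b y ^ 3))"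
    by (simp add: fun_eq_iff kernel_eq N_def A_def B_def C_def)
  let ?x = "z $ 1" and ?y = "z $ 2"
  have "partial 1 (partial 1 (kernel a b)) z
      = (M11 ?x ?y * s ?x ?y * q ?x ?y - 3 * ?x * M1 ?x ?y * q ?x ?y - 8 * a * ?x * M1 ?x ?y * s ?x ?y)
        / (norm z ^ 5 * quad a b z ^ 5)"
  proof (rule second_partial_eqI[OF _ _ z])
    show "((\<lambda>t. kernel a b (y + t *\<^sub>R axis 1 1)) has_field_derivative
        M1 (y $ 1) (y $ 2) / (norm y ^ 3 * quad a b y ^ 4)) (at 0)" if "y \<noteq> 0" for y
      unfolding K
      by (rule DERIV_cong[OF has_partial_over_norm_quad[OF pos that along1[of N, OF dN(1)]]])
         (simp add: M1_def sq axis_def mult_ac power3_eq_cube)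
    show "((\<lambda>t. M1 ((z + t *\<^sub>R axis 1 1) $ 1) ((z + t *\<^sub>R axis 1 1) $ 2)
          / (norm (z + t *\<^sub>R axis 1 1) ^ 3 * quad a b (z + t *\<^sub>R axis 1 1) ^ 4)) has_field_derivative
        (M11 ?x ?y * s ?x ?y * q ?x ?y - 3 * ?x * M1 ?x ?y * q ?x ?y - 8 * a * ?x * M1 ?x ?y * s ?x ?y)
        / (norm z ^ 5 * quad a b z ^ 5)) (at 0)"
      by (rule DERIV_cong[OF has_partial_over_norm_quad[OF pos z along1[of M1, OF dM(1)]]])
         (simp add: sq axis_def mult_ac)
  qed
  moreover have "partial 2 (partial 2 (kernel a b)) z
      = (M22 ?x ?y * s ?x ?y * q ?x ?y - 3 * ?y * M2 ?x ?y * q ?x ?y - 8 * b * ?y * M2 ?x ?y * s ?x ?y)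
        / (norm z ^ 5 * quad a b z ^ 5)"
  proof (rule second_partial_eqI[OF _ _ z])
    show "((\<lambda>t. kernel a b (y + t *\<^sub>R axis 2 1)) has_field_derivative
        M2 (y $ 1) (y $ 2) / (norm y ^ 3 * quad a b y ^ 4)) (at 0)" if "y \<noteq> 0" for y
      unfolding K
      by (rule DERIV_cong[OF has_partial_over_norm_quad[OF pos that along2[of N, OF dN(2)]]])
         (simp add: M2_def sq axis_def mult_ac power3_eq_cube)
    show "((\<lambda>t. M2 ((z + t *\<^sub>R axis 2 1) $ 1) ((z + t *\<^sub>R axis 2 1) $ 2)
          / (norm (z + t *\<^sub>R axis 2 1) ^ 3 * quad a b (z + t *\<^sub>R axis 2 1) ^ 4)) has_field_derivative
        (M22 ?x ?y * s ?x ?y * q ?x ?y - 3 * ?y * M2 ?x ?y * q ?x ?y - 8 * b * ?y * M2 ?x ?y * s ?x ?y)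
        / (norm z ^ 5 * quad a b z ^ 5)) (at 0)"
      by (rule DERIV_cong[OF has_partial_over_norm_quad[OF pos z along2[of M2, OF dM(2)]]])
         (simp add: sq axis_def mult_ac)
  qed
  \<comment> \<open>The factor \<open>q\<^sup>5\<close> that appears here cancels the denominator and leaves a multiple of \<open>1 / \<bar>z\<bar>\<^sup>5\<close>.\<close>
  moreover have "b * (M11 x y * s x y * q x y - 3 * x * M1 x y * q x y - 8 * a * x * M1 x y * s x y)
      + a * (M22 x y * s x y * q x y - 3 * y * M2 x y * q x y - 8 * b * y * M2 x y * s x y)
      = 9 * a * b * q x y ^ 5" for x y
    unfolding M11_def M22_def M1_def M2_def N1_def N2_def N_def s_def q_def A_def B_def C_def
    by algebra
  ultimately have "b * multi_deriv (2, 0) (kernel a b) z + a * multi_deriv (0, 2) (kernel a b) z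
      = 9 * a * b * quad a b z ^ 5 / (norm z ^ 5 * quad a b z ^ 5)"
    by (simp add: multi_deriv_def numeral_2_eq_2 sq(2) flip: add_divide_distrib)
  also have "\<dots> = a * b * (9 / norm z ^ 5)"
    using quad_pos[OF pos z] by simp
  finally show "b * multi_deriv (2, 0) (kernel a b) z + a * multi_deriv (0, 2) (kernel a b) z
      = a * b * (multi_deriv (2, 0) (\<lambda>w. 1 / norm w ^ 3) z
                 + multi_deriv (0, 2) (\<lambda>w. 1 / norm w ^ 3) z)"
    by (simp only: laplacian_norm_minus_3[OF z])
qed

text \<open>Up to the factor \<open>a b\<close>, the outer coefficients of the numerator are \<open>a (3 a - 2 b)\<close> and
  \<open>b (3 b - 2 a)\<close>, which the bounds on the ratio make positive. Half the middle one is
  \<open>3 (a - b)\<^sup>2 + a b\<close>.\<close>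

lemma kernel_pos:
  assumes pos: "0 < a" "0 < b" and ratio: "2 / 3 < a / b" "a / b < 3 / 2" and z: "z \<noteq> 0"
  shows "0 < kernel a b z"
proof -
  have "0 < a * (3 * a - 2 * b)" "0 < b * (3 * b - 2 * a)"
    using pos ratio by (simp_all add: field_simps)
  then have AC: "0 < 3 * a\<^sup>2 - 2 * a * b" "0 < 3 * b\<^sup>2 - 2 * a * b"
    by (simp_all add: algebra_simps power2_eq_square)
  have "0 \<le> 3 * (a - b)\<^sup>2 + a * b" using pos by simp
  also have "\<dots> = 3 * a\<^sup>2 - 5 * a * b + 3 * b\<^sup>2" by (simp add: algebra_simps power2_eq_square)
  finally have B: "0 \<le> 3 * a\<^sup>2 - 5 * a * b + 3 * b\<^sup>2" .
  have "z $ 1 \<noteq> 0 \<or> z $ 2 \<noteq> 0" using z by (auto simp: vec_eq_iff forall_2)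
  then have "0 < (3 * a\<^sup>2 - 2 * a * b) * (z $ 1) ^ 4 + (3 * b\<^sup>2 - 2 * a * b) * (z $ 2) ^ 4"
    using AC by (elim disjE) (simp_all add: add_pos_nonneg add_nonneg_pos)
  moreover have "0 \<le> 2 * (3 * a\<^sup>2 - 5 * a * b + 3 * b\<^sup>2) * (z $ 1)\<^sup>2 * (z $ 2)\<^sup>2"
    using B by simp
  ultimately show ?thesis
    using pos quad_pos[OF pos z] z unfolding kernel_eq
    by (intro divide_pos_pos mult_pos_pos) auto
qed

theorem proposition5p5:
  fixes C11 C13 C33 C44 C66 \<eta>1 \<eta>2 :: real and K :: "real^2 \<Rightarrow> real"
  assumes "0 < C66" and "C66 < C11" and "C13\<^sup>2 < C33 * (C11 - C66)" and "0 < C44"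
    and "\<eta>1 = eta1 C44 C66" and "\<eta>2 = eta2 C11 C13 C33 C44"
    and "0 < \<eta>1" and "0 < \<eta>2"
    and "K = kernel \<eta>1 \<eta>2"
  shows "(even_function K \<and> homogeneous_of_order (-3) K)
    \<and> (\<forall>a. \<exists>C. \<forall>x. x \<noteq> 0 \<longrightarrow> \<bar>monomial a x * multi_deriv a K x\<bar> < C / norm x ^ 3)
    \<and> (admissible_solution \<eta>1 \<eta>2 K
        \<and> (\<forall>f. admissible_solution \<eta>1 \<eta>2 f \<longrightarrow> (\<forall>x. x \<noteq> 0 \<longrightarrow> f x = K x)))
    \<and> (2 / 3 < \<eta>1 / \<eta>2 \<and> \<eta>1 / \<eta>2 < 3 / 2 \<longrightarrow>
        (\<exists>c>0. \<exists>C>0. \<forall>x. x \<noteq> 0 \<longrightarrow> c / norm x ^ 3 \<le> K x \<and> K x \<le> C / norm x ^ 3))"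
proof (intro conjI allI impI)
  note pos = \<open>0 < \<eta>1\<close> \<open>0 < \<eta>2\<close>
  note K = \<open>K = kernel \<eta>1 \<eta>2\<close>
  have smooth: "C_infinity_on K (UNIV - {0})" unfolding K by (rule C_infinity_on_kernel[OF pos])
  show even: "even_function K" unfolding K by (rule kernel_even)
  show hom: "homogeneous_of_order (-3) K" unfolding K by (rule kernel_homogeneous)
  show adm: "admissible_solution \<eta>1 \<eta>2 K"
    using smooth even hom kernel_solves_pde[OF pos] unfolding admissible_solution_def K by blast
  show "f x = K x" if "admissible_solution \<eta>1 \<eta>2 f" "x \<noteq> 0" for f x
    by (rule homogeneous_kernel_equation_unique[OF pos that(1) adm that(2)])
  show "\<exists>C. \<forall>x. x \<noteq> 0 \<longrightarrow> \<bar>monomial a x * multi_deriv a K x\<bar> < C / norm x ^ 3" for a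
    using homogeneous_upper_bound[OF homogeneous_monomial_multi_deriv(2,1)[OF smooth hom, of a]]
    by metis
  show "\<exists>c>0. \<exists>C>0. \<forall>x. x \<noteq> 0 \<longrightarrow> c / norm x ^ 3 \<le> K x \<and> K x \<le> C / norm x ^ 3"
    if ratio: "2 / 3 < \<eta>1 / \<eta>2 \<and> \<eta>1 / \<eta>2 < 3 / 2"
  proof -
    note cont = C_infinity_on_imp_continuous_on[OF smooth]
    have "0 < K x" if "x \<noteq> 0" for x
      unfolding K by (rule kernel_pos[OF pos _ _ that]) (use ratio in auto)
    then obtain c where c: "0 < c" "\<And>x. x \<noteq> 0 \<Longrightarrow> c / norm x ^ 3 \<le> K x"
      using homogeneous_lower_bound[OF cont hom] by blast
    obtain C where "0 < C" "\<And>x. x \<noteq> 0 \<Longrightarrow> \<bar>K x\<bar> < C / norm x ^ 3"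
      using homogeneous_upper_bound[OF cont hom] by blast
    then show ?thesis using c by (meson abs_le_D1 less_imp_le)
  qed
qed

end
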